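(* Let $\mathcal{T}$ be a cluster tree of depth $L$ and let $A$ be the matrix generated by a standard telescopic decomposition $\{U_\tau,V_\tau,D_\tau\}_{\tau\in\mathcal{T}}$ of telescopic rank $r$. Then, for each non-leaf node $\tau$ with children $\alpha,\beta$, there exist matrices $\tilde A_{\alpha,\beta},\tilde A_{\beta,\alpha}\in\mathbb{R}^{r\times r}$ such that $$D_\tau=\begin{bmatrix}0&\tilde A_{\alpha,\beta}\\ \tilde A_{\beta,\alpha}&0\end{bmatrix}.$$ Moreover, $A$ is an HSS matrix of HSS rank $r$ for $\mathcal{T}$ with the data-sparse representation consisting of $U_\tau,V_\tau$ (for non-root nodes $\tau\in\mathcal{T}$), $\tilde A_{\tau,\tau'}$ (for sibling nodes $\tau,\tau'$), and $A_{\alpha,\alpha}$ (for leaf nodes $\alpha$).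
   Context: **Cluster trees.** A cluster tree $\mathcal{T}$ of depth $L$ for $I=[1,\dots,n]$ is a perfect binary tree of depth $L$ whose root $\gamma$ is associated with $I$, and such that each non-leaf node $\tau$ with index vector $I_\tau$ has two children $\alpha,\beta$ (in this order) associated with vectors of consecutive indices $I_\alpha,I_\beta$ whose concatenation is $I_\tau$. The depth of a node is its distance from the root; $|\tau|$ is the length of $I_\tau$. $A_{\tau,\tau'}$ is the submatrix of $A$ with row indices $I_\tau$ and column indices $I_{\tau'}$. Siblings are distinct children of the same node. For integers $m,\ell$, $\mathcal{T}_m^{(\ell)}$ is the balanced cluster tree of depth $\ell$ for $[1,\dots,2^\ell m]$ with leaves associated with $[(i-1)m+1,\dots,im]$, $i=1,\dots,2^\ell$; for $\ell<L$ its nodes are identified with the nodes of $\mathcal{T}$ of depth at most $\ell$. For matrices $C_\tau$ indexed by nodes, $\boldsymbol{C}^{(\ell)}$ denotes the block diagonal matrix whose diagonal blocks are the $C_\tau$ with $\mathrm{depth}(\tau)=\ell$, in natural (left-to-right) order. **Telescopic decompositions.** A telescopic decomposition $\{U_\tau,V_\tau,D_\tau\}_{\tau\in\mathcal{T}}$ of telescopic rank $r$ consists of real matrices $U_\tau,V_\tau$ (for $\mathrm{depth}(\tau)\ge 1$) and $D_\tau$ (all $\tau$) such that: $D_\tau$ is $|\tau|\times|\tau|$ if $\mathrm{depth}(\tau)=L$ and $2r\times2r$ otherwise; $U_\tau,V_\tau$ have orthonormal columns and are $|\tau|\times r$ if $\mathrm{depth}(\tau)=L$ and $2r\times r$ otherwise.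 Put $A^{(0)}:=D_\gamma$ and $A^{(\ell)}:=\boldsymbol{D}^{(\ell)}+\boldsymbol{U}^{(\ell)}A^{(\ell-1)}(\boldsymbol{V}^{(\ell)})^T$ for $\ell=1,\dots,L$. The matrix generated by the decomposition is $A:=A^{(L)}$. **Standard.** The telescopic decomposition is called standard if for every $1\le\ell\le L$ and every node $\tau$ of depth $\ell$ the diagonal block $(A^{(\ell)})_{\tau,\tau}$ of $A^{(\ell)}$ corresponding to $\tau$ (with respect to $\mathcal{T}_{2r}^{(\ell)}$ if $\ell<L$, and $\mathcal{T}$ if $\ell=L$) equals $D_\tau$. **HSS matrices and data-sparse representation.** $A\in\mathbb{R}^{n\times n}$ is an HSS matrix of HSS rank $r$ for $\mathcal{T}$ if: (1) for each pair of siblings $\tau,\tau'$ there are $U_\tau^{(\mathrm{big})}\in\mathbb{R}^{|\tau|\times r}$, $V_{\tau'}^{(\mathrm{big})}\in\mathbb{R}^{|\tau'|\times r}$ with orthonormal columns (one such pair $U^{(\mathrm{big})}_\tau,V^{(\mathrm{big})}_\tau$ for each non-root node $\tau$) and $\tilde A_{\tau,\tau'}\in\mathbb{R}^{r\times r}$ with $A_{\tau,\tau'}=U_\tau^{(\mathrm{big})}\tilde A_{\tau,\tau'}(V_{\tau'}^{(\mathrm{big})})^T$; (2) for each non-leaf, non-root node $\tau$ with children $\alpha,\beta$ there are $U_\tau,V_\tau\in\mathbb{R}^{2r\times r}$ with orthonormal columns such that $U_\tau^{(\mathrm{big})}=\mathrm{blkdiag}(U_\alpha^{(\mathrm{big})},U_\beta^{(\mathrm{big})})U_\tau$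 and $V_\tau^{(\mathrm{big})}=\mathrm{blkdiag}(V_\alpha^{(\mathrm{big})},V_\beta^{(\mathrm{big})})V_\tau$. For a (non-root) leaf $\tau$ set $U_\tau:=U_\tau^{(\mathrm{big})}$, $V_\tau:=V_\tau^{(\mathrm{big})}$. The data-sparse representation of $A$ consists of all these $U_\tau,V_\tau$, the $\tilde A_{\tau,\tau'}$ for siblings $\tau,\tau'$, and the diagonal blocks $A_{\alpha,\alpha}$ for leaves $\alpha$. *)

theory Defs
  imports "Jordan_Normal_Form.Matrix" "Jordan_Normal_Form.DL_Submatrix"
begin

section \<open>Cluster trees\<close>

text \<open>The node \<open>(l, i)\<close> with \<open>i < 2 ^ l\<close> is the \<open>i\<close>-th node from the left (counting from 0) among
  the nodes of depth \<open>l\<close> of a perfect binary tree. With this addressing, the nodes of a tree of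
  smaller depth are literally the upper nodes of a deeper one.\<close>

type_synonym node = "nat \<times> nat"

abbreviation depth :: "node \<Rightarrow> nat" where "depth \<equiv> fst"

definition nodes :: "nat \<Rightarrow> node set" where
  "nodes L = {(l, i). l \<le> L \<and> i < 2 ^ l}"

definition root :: node where "root = (0, 0)"

definition lchild :: "node \<Rightarrow> node" where "lchild \<tau> = (Suc (fst \<tau>), 2 * snd \<tau>)"

definition rchild :: "node \<Rightarrow> node" where "rchild \<tau> = (Suc (fst \<tau>), 2 * snd \<tau> + 1)"

definition siblings :: "nat \<Rightarrow> node \<Rightarrow> node \<Rightarrow> bool" where
  "siblings L \<tau> \<tau>' \<longleftrightarrow> (\<exists>\<sigma>\<in>nodes L. depth \<sigma> < L \<and>
     (\<tau> = lchild \<sigma> \<and> \<tau>' = rchild \<sigma> \<or> \<tau> = rchild \<sigma> \<and> \<tau>' = lchild \<sigma>))"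

text \<open>Row and column indices start at 0, as usual for matrices here, so the index vector of
  the root is \<open>[0..<n]\<close> rather than \<open>[1..n]\<close>. The shape of the tree is determined by \<open>L\<close>, hence a
  cluster tree is given by \<open>L\<close> and the map \<open>I\<close> from nodes to index vectors.\<close>

definition cluster_tree :: "nat \<Rightarrow> nat \<Rightarrow> (node \<Rightarrow> nat list) \<Rightarrow> bool" where
  "cluster_tree L n I \<longleftrightarrow>
     I root = [0..<n] \<and>
     (\<forall>\<tau>\<in>nodes L. \<exists>a b. I \<tau> = [a..<b]) \<and>
     (\<forall>\<tau>\<in>nodes L. depth \<tau> < L \<longrightarrow> I \<tau> = I (lchild \<tau>) @ I (rchild \<tau>))"

text \<open>Index vectors of the balanced cluster tree of depth \<open>l\<close> whose leaves all have \<open>m\<close> indices.\<close>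

definition balanced_tree :: "nat \<Rightarrow> nat \<Rightarrow> node \<Rightarrow> nat list" where
  "balanced_tree m l \<tau> =
     [snd \<tau> * (2 ^ (l - fst \<tau>) * m) ..< (snd \<tau> + 1) * (2 ^ (l - fst \<tau>) * m)]"

lemma balanced_tree_leaf: "balanced_tree m l (l, i) = [i * m ..< (i + 1) * m]"
  by (simp add: balanced_tree_def)

lemma cluster_tree_balanced_tree: "cluster_tree l (2 ^ l * m) (balanced_tree m l)"
proof -
  have "balanced_tree m l \<tau> = balanced_tree m l (lchild \<tau>) @ balanced_tree m l (rchild \<tau>)"
    if "depth \<tau> < l" for \<tau>
  proof -
    obtain k i where \<tau>: "\<tau> = (k, i)" by force
    define c :: nat where "c = 2 ^ (l - Suc k) * m"
    have c: "2 ^ (l - k) * m = 2 * c" using that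
      by (simp add: \<tau> c_def Suc_diff_Suc flip: power_Suc)
    have "[i * (2 * c) ..< (i + 1) * (2 * c)] =
        [2 * i * c ..< (2 * i + 1) * c] @ [(2 * i + 1) * c ..< (2 * i + 1 + 1) * c]"
      using upt_add_eq_append[of "2 * i * c" "(2 * i + 1) * c" c]
      by (simp add: algebra_simps)
    then show ?thesis
      unfolding balanced_tree_def lchild_def rchild_def \<tau> fst_conv snd_conv c c_def[symmetric]
      by (simp only: mult.commute[of i 2])
  qed
  then show ?thesis by (auto simp: cluster_tree_def balanced_tree_def root_def)
qed

section \<open>Blocks\<close>

definition block :: "(node \<Rightarrow> nat list) \<Rightarrow> real mat \<Rightarrow> node \<Rightarrow> node \<Rightarrow> real mat" where
  "block I A \<tau> \<tau>' = submatrix A (set (I \<tau>)) (set (I \<tau>'))"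

definition blkdiag :: "(node \<Rightarrow> real mat) \<Rightarrow> nat \<Rightarrow> real mat" where
  "blkdiag C l = diag_block_mat (map (\<lambda>i. C (l, i)) [0..<2 ^ l])"

definition orthonormal_cols :: "real mat \<Rightarrow> bool" where
  "orthonormal_cols U \<longleftrightarrow>
     (\<forall>i<dim_col U. \<forall>j<dim_col U. col U i \<bullet> col U j = (if i = j then 1 else 0))"

section \<open>Telescopic decompositions\<close>

definition telescopic_decomposition ::
  "nat \<Rightarrow> (node \<Rightarrow> nat list) \<Rightarrow> nat \<Rightarrow>
   (node \<Rightarrow> real mat) \<Rightarrow> (node \<Rightarrow> real mat) \<Rightarrow> (node \<Rightarrow> real mat) \<Rightarrow> bool" where
  "telescopic_decomposition L I r U V D \<longleftrightarrow>
     (\<forall>\<tau>\<in>nodes L.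
        let d = (if depth \<tau> = L then length (I \<tau>) else 2 * r) in
        D \<tau> \<in> carrier_mat d d \<and>
        (depth \<tau> \<ge> 1 \<longrightarrow>
           U \<tau> \<in> carrier_mat d r \<and> orthonormal_cols (U \<tau>) \<and>
           V \<tau> \<in> carrier_mat d r \<and> orthonormal_cols (V \<tau>)))"

fun telescopic_mat ::
  "(node \<Rightarrow> real mat) \<Rightarrow> (node \<Rightarrow> real mat) \<Rightarrow> (node \<Rightarrow> real mat) \<Rightarrow> nat \<Rightarrow> real mat" where
  "telescopic_mat U V D 0 = D root"
| "telescopic_mat U V D (Suc l) =
     blkdiag D (Suc l) + blkdiag U (Suc l) * telescopic_mat U V D l * (blkdiag V (Suc l))\<^sup>T"

definition standard_decomposition ::
  "nat \<Rightarrow> (node \<Rightarrow> nat list) \<Rightarrow> nat \<Rightarrow>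
   (node \<Rightarrow> real mat) \<Rightarrow> (node \<Rightarrow> real mat) \<Rightarrow> (node \<Rightarrow> real mat) \<Rightarrow> bool" where
  "standard_decomposition L I r U V D \<longleftrightarrow>
     (\<forall>l. 1 \<le> l \<and> l \<le> L \<longrightarrow> (\<forall>\<tau>\<in>nodes L. depth \<tau> = l \<longrightarrow>
        block (if l < L then balanced_tree (2 * r) l else I) (telescopic_mat U V D l) \<tau> \<tau> = D \<tau>))"

section \<open>HSS matrices\<close>

text \<open>\<open>Ub\<close>, \<open>Vb\<close> are the ``big'' basis matrices. The values of \<open>U\<close>, \<open>V\<close> are constrained here only at
  nodes that are neither leaves nor the root; the convention for leaves is part of
  \<open>data_sparse_representation\<close> below.\<close>

definition hss_factorization ::
  "nat \<Rightarrow> nat \<Rightarrow> (node \<Rightarrow> nat list) \<Rightarrow> nat \<Rightarrow> real mat \<Rightarrow>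
   (node \<Rightarrow> real mat) \<Rightarrow> (node \<Rightarrow> real mat) \<Rightarrow> (node \<Rightarrow> real mat) \<Rightarrow> (node \<Rightarrow> real mat) \<Rightarrow>
   (node \<Rightarrow> node \<Rightarrow> real mat) \<Rightarrow> bool" where
  "hss_factorization L n I r A Ub Vb U V At \<longleftrightarrow>
     A \<in> carrier_mat n n \<and>
     (\<forall>\<tau>\<in>nodes L. depth \<tau> \<ge> 1 \<longrightarrow>
        Ub \<tau> \<in> carrier_mat (length (I \<tau>)) r \<and> orthonormal_cols (Ub \<tau>) \<and>
        Vb \<tau> \<in> carrier_mat (length (I \<tau>)) r \<and> orthonormal_cols (Vb \<tau>)) \<and>
     (\<forall>\<tau> \<tau>'. siblings L \<tau> \<tau>' \<longrightarrow>
        At \<tau> \<tau>' \<in> carrier_mat r r \<and> block I A \<tau> \<tau>' = Ub \<tau> * At \<tau> \<tau>' * (Vb \<tau>')\<^sup>T) \<and>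
     (\<forall>\<tau>\<in>nodes L. 1 \<le> depth \<tau> \<and> depth \<tau> < L \<longrightarrow>
        U \<tau> \<in> carrier_mat (2 * r) r \<and> orthonormal_cols (U \<tau>) \<and>
        V \<tau> \<in> carrier_mat (2 * r) r \<and> orthonormal_cols (V \<tau>) \<and>
        Ub \<tau> = diag_block_mat [Ub (lchild \<tau>), Ub (rchild \<tau>)] * U \<tau> \<and>
        Vb \<tau> = diag_block_mat [Vb (lchild \<tau>), Vb (rchild \<tau>)] * V \<tau>)"

definition hss_matrix :: "nat \<Rightarrow> nat \<Rightarrow> (node \<Rightarrow> nat list) \<Rightarrow> nat \<Rightarrow> real mat \<Rightarrow> bool" where
  "hss_matrix L n I r A \<longleftrightarrow> (\<exists>Ub Vb U V At. hss_factorization L n I r A Ub Vb U V At)"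

text \<open>\<open>Dg\<close> holds the diagonal blocks of the leaves. Values of \<open>U\<close>, \<open>V\<close> at the root, of \<open>At\<close> at pairs that
  are not siblings, and of \<open>Dg\<close> at non-leaves are irrelevant.\<close>

definition data_sparse_representation ::
  "nat \<Rightarrow> nat \<Rightarrow> (node \<Rightarrow> nat list) \<Rightarrow> nat \<Rightarrow> real mat \<Rightarrow>
   (node \<Rightarrow> real mat) \<Rightarrow> (node \<Rightarrow> real mat) \<Rightarrow> (node \<Rightarrow> node \<Rightarrow> real mat) \<Rightarrow>
   (node \<Rightarrow> real mat) \<Rightarrow> bool" where
  "data_sparse_representation L n I r A U V At Dg \<longleftrightarrow>
     (\<exists>Ub Vb. hss_factorization L n I r A Ub Vb U V At \<and>
        (\<forall>\<tau>\<in>nodes L. depth \<tau> = L \<and> depth \<tau> \<ge> 1 \<longrightarrow> U \<tau> = Ub \<tau> \<and> V \<tau> = Vb \<tau>)) \<and>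
     (\<forall>\<alpha>\<in>nodes L. depth \<alpha> = L \<longrightarrow> Dg \<alpha> = block I A \<alpha> \<alpha>)"

end

theory Submission
  imports Defs
begin

text \<open>
  Write \<open>A\<^sup>l\<close> for \<open>telescopic_mat U V D l\<close>. Its rows and columns can be grouped in two ways: by the
  nodes of depth \<open>l\<close>, and, if \<open>l < L\<close>, more finely by the nodes of depth \<open>l + 1\<close>, each of which owns
  \<open>r\<close> consecutive indices, because \<open>A\<^sup>l\<close> is multiplied by the factors \<open>U \<tau>\<close> and \<open>V \<tau>\<close> of these nodes
  when \<open>A\<^bsup>l+1\<^esup>\<close> is formed. Call the \<open>r \<times> r\<close> blocks of the fine partition cores. As the outer factors
  are block diagonal, the recursion can be read one block at a time (\<open>telescopic_block\<close>): the
  \<open>(\<tau>, \<tau>')\<close> block of \<open>A\<^bsup>l+1\<^esup>\<close> is \<open>U \<tau> * X * (V \<tau>')\<^sup>T\<close> with \<open>X\<close> the \<open>(\<tau>, \<tau>')\<close> core of \<open>A\<^sup>l\<close>,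
  plus \<open>D \<tau>\<close> if \<open>\<tau> = \<tau>'\<close>.

  On the diagonal, being standard says that \<open>D \<tau> = D \<tau> + U \<tau> * X * (V \<tau>)\<^sup>T\<close>. Since \<open>U \<tau>\<close> and \<open>V \<tau>\<close>
  have orthonormal columns, the core \<open>X\<close> vanishes (\<open>core_diagonal\<close>). For a non-leaf \<open>\<tau>\<close> the
  matrix \<open>D \<tau>\<close> is the diagonal block of \<open>A\<^sup>l\<close> at \<open>\<tau>\<close>, hence consists of the four cores of the
  children of \<open>\<tau>\<close>, and the two diagonal ones are zero. This is the first claim
  (\<open>D_eq_four_block\<close>), with the off-diagonal cores in the role of the coupling matrices.

  Off the diagonal, the \<open>(\<tau>, \<tau>')\<close> block of \<open>A\<close> is the \<open>(\<tau>, \<tau>')\<close> core of \<open>A\<^sup>l\<close> multiplied by the big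
  bases of \<open>\<tau>\<close> and \<open>\<tau>'\<close>, for all distinct nodes of depth \<open>l + 1\<close> and not only for siblings
  (\<open>off_diagonal_block\<close>). This goes by induction from the leaves to the root: the four blocks for
  the children of \<open>\<tau>\<close> and \<open>\<tau>'\<close> have this form, their cores make up the \<open>(\<tau>, \<tau>')\<close> block
  \<open>U \<tau> * X * (V \<tau>')\<^sup>T\<close> of the next coarser matrix, and \<open>U \<tau>\<close>, \<open>V \<tau>'\<close> are absorbed by the bases as the
  nestedness condition prescribes. At siblings this is the HSS factorization.
\<close>

section \<open>Contiguous blocks of a matrix\<close>

definition cut :: "nat \<Rightarrow> nat \<Rightarrow> nat \<Rightarrow> nat \<Rightarrow> 'a mat \<Rightarrow> 'a mat" where
  "cut a p b q M = mat p q (\<lambda>(x, y). M $$ (a + x, b + y))"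

lemma cut_carrier [simp]: "cut a p b q M \<in> carrier_mat p q"
  and dim_cut [simp]: "dim_row (cut a p b q M) = p" "dim_col (cut a p b q M) = q"
  and index_cut [simp]: "x < p \<Longrightarrow> y < q \<Longrightarrow> cut a p b q M $$ (x, y) = M $$ (a + x, b + y)"
  by (simp_all add: cut_def)

lemma cut_add:
  "M \<in> carrier_mat m m' \<Longrightarrow> N \<in> carrier_mat m m' \<Longrightarrow> a + p \<le> m \<Longrightarrow> b + q \<le> m' \<Longrightarrow>
   cut a p b q (M + N) = cut a p b q M + cut a p b q N"
  by (intro eq_matI) auto

lemma cut_transpose:
  "M \<in> carrier_mat m m' \<Longrightarrow> a + p \<le> m \<Longrightarrow> b + q \<le> m' \<Longrightarrow> cut b q a p M\<^sup>T = (cut a p b q M)\<^sup>T"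
  by (intro eq_matI) auto

lemma cut_whole: "M \<in> carrier_mat p q \<Longrightarrow> cut 0 p 0 q M = M"
  by (intro eq_matI) auto

lemma cut_four_blocks:
  "cut a (p + p') b (q + q') M =
   four_block_mat (cut a p b q M) (cut a p (b + q) q' M)
     (cut (a + p) p' b q M) (cut (a + p) p' (b + q) q' M)"
  by (intro eq_matI) auto

text \<open>Blocks in a cluster tree have intervals as index sets, so that choosing a submatrix amounts
  to shifting the indices.\<close>
lemma pick_interval: "i < p \<Longrightarrow> pick {a..<a + p} i = a + i"
proof (induction i)
  case 0
  then show ?case by (auto intro!: Least_equality)
next
  case (Suc i)
  then show ?case by (auto intro!: Least_equality)
qed

lemma submatrix_interval:
  assumes "M \<in> carrier_mat m m'" "a + p \<le> m" "b + q \<le> m'"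
  shows "submatrix M {a..<a + p} {b..<b + q} = cut a p b q M"
proof -
  have "{i. i < dim_row M \<and> i \<in> {a..<a + p}} = {a..<a + p}"
    "{j. j < dim_col M \<and> j \<in> {b..<b + q}} = {b..<b + q}"
    using assms by auto
  then show ?thesis
    unfolding submatrix_def by (intro eq_matI) (auto simp: pick_interval)
qed

section \<open>Block diagonal factors\<close>

lemma dim_diag_block_map:
  "dim_row (diag_block_mat (map C [0..<N])) = (\<Sum>k<N. dim_row (C k))"
  "dim_col (diag_block_mat (map C [0..<N])) = (\<Sum>k<N. dim_col (C k))"
  by (simp_all add: dim_diag_block_mat interv_sum_list_conv_sum_set_nat atLeast0LessThan o_def)

text \<open>The row is given relative to its diagonal block, while the column is arbitrary. In this form
  the lemma yields both the blocks themselves and the inner products of a product with a block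
  diagonal matrix.\<close>
lemma index_diag_block_map:
  assumes "i < N" "x < dim_row (C i)" "k < (\<Sum>j<N. dim_col (C j))"
  shows "diag_block_mat (map C [0..<N]) $$ ((\<Sum>j<i. dim_row (C j)) + x, k) =
    (if (\<Sum>j<i. dim_col (C j)) \<le> k \<and> k < (\<Sum>j<Suc i. dim_col (C j))
     then C i $$ (x, k - (\<Sum>j<i. dim_col (C j))) else 0)"
  using assms
proof (induction N)
  case (Suc N)
  have less: "(\<Sum>j<i. dim_row (C j)) + x < (\<Sum>j<N. dim_row (C j))"
    and le: "(\<Sum>j<Suc i. dim_col (C j)) \<le> (\<Sum>j<N. dim_col (C j))" if "i < N"
  proof -
    have "(\<Sum>j<Suc i. dim_row (C j)) \<le> (\<Sum>j<N. dim_row (C j))"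
      using that by (intro sum_mono2) auto
    then show "(\<Sum>j<i. dim_row (C j)) + x < (\<Sum>j<N. dim_row (C j))" using Suc.prems by simp
    show "(\<Sum>j<Suc i. dim_col (C j)) \<le> (\<Sum>j<N. dim_col (C j))"
      using that by (intro sum_mono2) auto
  qed
  show ?case
  proof (cases "i = N")
    case True
    then show ?thesis using Suc.prems
      by (auto simp: diag_block_mat_last Let_def dim_diag_block_map)
  next
    case False
    then show ?thesis using Suc less le
      by (auto simp: diag_block_mat_last Let_def dim_diag_block_map)
  qed
qed simp

lemma sum_lessThan_block_le: "i < N \<Longrightarrow> (\<Sum>j<i. f j) + f i \<le> (\<Sum>j<N. f j)" for f :: "nat \<Rightarrow> nat"
  using sum_mono2[of "{..<N}" "{..<Suc i}" f] by auto

text \<open>A row of the \<open>i\<close>-th block row is supported on the columns of the \<open>i\<close>-th block, so only the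
  corresponding rows of the other factor contribute.\<close>
lemma cut_diag_block_mult:
  fixes M :: "'a :: semiring_0 mat"
  assumes i: "i < N" and M: "M \<in> carrier_mat (\<Sum>k<N. dim_col (C k)) m" and bq: "b + q \<le> m"
  shows "cut (\<Sum>k<i. dim_row (C k)) (dim_row (C i)) b q (diag_block_mat (map C [0..<N]) * M) =
    C i * cut (\<Sum>k<i. dim_col (C k)) (dim_col (C i)) b q M" (is "?l = ?r")
proof (rule eq_matI)
  fix x y assume "x < dim_row ?r" "y < dim_col ?r"
  then have x: "x < dim_row (C i)" and y: "y < q" by auto
  let ?R = "\<Sum>k<i. dim_row (C k)" and ?o = "\<Sum>k<i. dim_col (C k)" and ?n = "\<Sum>k<N. dim_col (C k)"
  let ?D = "diag_block_mat (map C [0..<N])"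
  have R: "?R + x < (\<Sum>k<N. dim_row (C k))"
    using sum_lessThan_block_le[OF i, of "\<lambda>k. dim_row (C k)"] x by linarith
  have o: "?o + dim_col (C i) \<le> ?n" by (rule sum_lessThan_block_le[OF i])
  have "?l $$ (x, y) = (\<Sum>k<?n. ?D $$ (?R + x, k) * M $$ (k, b + y))"
    using M R x y bq
    by (simp add: scalar_prod_def dim_diag_block_map atLeast0LessThan)
  also have "\<dots> = (\<Sum>k\<in>{?o..<?o + dim_col (C i)}. C i $$ (x, k - ?o) * M $$ (k, b + y))"
    using o by (intro sum.mono_neutral_cong_right) (auto simp: index_diag_block_map[of i N x C, OF i x])
  also have "\<dots> = (\<Sum>k<dim_col (C i). C i $$ (x, k) * M $$ (?o + k, b + y))"
    by (rule sum.reindex_bij_witness[of _ "\<lambda>k. ?o + k" "\<lambda>k. k - ?o"]) auto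
  also have "\<dots> = ?r $$ (x, y)"
    using x y by (simp add: scalar_prod_def atLeast0LessThan)
  finally show "?l $$ (x, y) = ?r $$ (x, y)" .
qed auto

text \<open>The right factor follows from the case of a left factor by transposition.\<close>
lemma cut_diag_block_sandwich:
  fixes M :: "'a :: comm_semiring_0 mat"
  assumes i: "i < N" and j: "j < K"
    and M: "M \<in> carrier_mat (\<Sum>k<N. dim_col (B k)) (\<Sum>k<K. dim_col (C k))"
  shows "cut (\<Sum>k<i. dim_row (B k)) (dim_row (B i)) (\<Sum>k<j. dim_row (C k)) (dim_row (C j))
      (diag_block_mat (map B [0..<N]) * M * (diag_block_mat (map C [0..<K]))\<^sup>T) =
    B i * cut (\<Sum>k<i. dim_col (B k)) (dim_col (B i)) (\<Sum>k<j. dim_col (C k)) (dim_col (C j)) M * (C j)\<^sup>T"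
proof -
  let ?B = "diag_block_mat (map B [0..<N])" and ?C = "diag_block_mat (map C [0..<K])"
  let ?R = "\<Sum>k<i. dim_row (B k)" and ?o = "\<Sum>k<i. dim_col (B k)"
  let ?R' = "\<Sum>k<j. dim_row (C k)" and ?o' = "\<Sum>k<j. dim_col (C k)"
  have B: "?B \<in> carrier_mat (\<Sum>k<N. dim_row (B k)) (\<Sum>k<N. dim_col (B k))"
    and C: "?C \<in> carrier_mat (\<Sum>k<K. dim_row (C k)) (\<Sum>k<K. dim_col (C k))"
    by (auto simp: dim_diag_block_map)
  let ?X = "M * ?C\<^sup>T"
  have CT: "?C\<^sup>T \<in> carrier_mat (\<Sum>k<K. dim_col (C k)) (\<Sum>k<K. dim_row (C k))" using C by auto
  have X: "?X \<in> carrier_mat (\<Sum>k<N. dim_col (B k)) (\<Sum>k<K. dim_row (C k))"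
    using M CT by auto
  note oi = sum_lessThan_block_le[OF i, of "\<lambda>k. dim_col (B k)"]
  note oj = sum_lessThan_block_le[OF j, of "\<lambda>k. dim_col (C k)"]
  note rj = sum_lessThan_block_le[OF j, of "\<lambda>k. dim_row (C k)"]
  have "cut ?o (dim_col (B i)) ?R' (dim_row (C j)) ?X =
      (cut ?R' (dim_row (C j)) ?o (dim_col (B i)) (?C * M\<^sup>T))\<^sup>T"
    using cut_transpose[of "?C * M\<^sup>T" "\<Sum>k<K. dim_row (C k)" "\<Sum>k<N. dim_col (B k)" ?R' "dim_row (C j)" ?o "dim_col (B i)"]
      C M oi rj transpose_mult[OF C, of "M\<^sup>T"] by auto
  also have "\<dots> = (C j * cut ?o' (dim_col (C j)) ?o (dim_col (B i)) M\<^sup>T)\<^sup>T"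
    using cut_diag_block_mult[OF j, of "M\<^sup>T" C "\<Sum>k<N. dim_col (B k)"] M oi by auto
  also have "\<dots> = cut ?o (dim_col (B i)) ?o' (dim_col (C j)) M * (C j)\<^sup>T"
    using cut_transpose[OF M oi oj] by (subst transpose_mult) auto
  finally have 1: "cut ?o (dim_col (B i)) ?R' (dim_row (C j)) ?X =
    cut ?o (dim_col (B i)) ?o' (dim_col (C j)) M * (C j)\<^sup>T" .
  have "cut ?R (dim_row (B i)) ?R' (dim_row (C j)) (?B * M * ?C\<^sup>T) =
    cut ?R (dim_row (B i)) ?R' (dim_row (C j)) (?B * ?X)"
    using assoc_mult_mat[OF B M CT] by simp
  also have "\<dots> = B i * cut ?o (dim_col (B i)) ?R' (dim_row (C j)) ?X"
    by (rule cut_diag_block_mult[OF i X rj])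
  also have "\<dots> = B i * cut ?o (dim_col (B i)) ?o' (dim_col (C j)) M * (C j)\<^sup>T"
    unfolding 1 using assoc_mult_mat[of "B i" _ "dim_col (B i)"] 
    by (metis assoc_mult_mat carrier_matI carrier_mat_triv cut_carrier dim_cut index_transpose_mat(2))
  finally show ?thesis .
qed

lemma cut_diag_block:
  fixes C :: "nat \<Rightarrow> 'a :: zero mat"
  assumes i: "i < N" and j: "j < N"
  shows "cut (\<Sum>k<i. dim_row (C k)) (dim_row (C i)) (\<Sum>k<j. dim_col (C k)) (dim_col (C j))
      (diag_block_mat (map C [0..<N])) = (if i = j then C i else 0\<^sub>m (dim_row (C i)) (dim_col (C j)))"
    (is "?l = ?r")
proof (rule eq_matI)
  fix x y assume "x < dim_row ?r" "y < dim_col ?r"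
  then have x: "x < dim_row (C i)" and y: "y < dim_col (C j)" by (auto split: if_splits)
  note oj = sum_lessThan_block_le[OF j, of "\<lambda>k. dim_col (C k)"]
  note le = sum_lessThan_block_le[of _ _ "\<lambda>k. dim_col (C k)"]
  show "?l $$ (x, y) = ?r $$ (x, y)"
    using x y oj le[of i j] le[of j i]
      index_diag_block_map[of i N x C "(\<Sum>k<j. dim_col (C k)) + y", OF i x]
    by (cases i j rule: linorder_cases) auto
qed auto

section \<open>Index intervals of a cluster tree\<close>

lemma concat_map_even_odd:
  "concat (map f [0..<2 * m]) = concat (map (\<lambda>i. f (2 * i) @ f (Suc (2 * i))) [0..<m])"
  by (induction m) auto

text \<open>Passing to the next depth replaces each index vector by the concatenation of those of its
  children, which does not change the concatenation over the whole level.\<close>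
lemma cluster_tree_level_concat:
  assumes "cluster_tree L n J" "l \<le> L"
  shows "concat (map (\<lambda>i. J (l, i)) [0..<2 ^ l]) = [0..<n]"
  using assms(2)
proof (induction l)
  case 0
  then show ?case using assms(1) by (auto simp: cluster_tree_def root_def)
next
  case (Suc l)
  have "J (l, i) = J (Suc l, 2 * i) @ J (Suc l, Suc (2 * i))" if "i < 2 ^ l" for i
    using assms(1) Suc.prems that by (auto simp: cluster_tree_def nodes_def lchild_def rchild_def)
  then have "map (\<lambda>i. J (l, i)) [0..<2 ^ l] =
      map (\<lambda>i. J (Suc l, 2 * i) @ J (Suc l, Suc (2 * i))) [0..<2 ^ l]" by auto
  moreover have "concat (map (\<lambda>i. J (l, i)) [0..<2 ^ l]) = [0..<n]" using Suc by simp
  ultimately show ?case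
    using concat_map_even_odd[of "\<lambda>i. J (Suc l, i)" "2 ^ l"] by (simp only: power_Suc)
qed

definition start :: "(node \<Rightarrow> nat list) \<Rightarrow> node \<Rightarrow> nat" where
  "start J \<tau> = (\<Sum>k<snd \<tau>. length (J (fst \<tau>, k)))"

text \<open>Only for nonempty vectors do the bounds in the definition of a cluster tree determine the
  left end. Summing the lengths to the left of the node gives a bound that is also right for empty
  vectors and agrees with the offsets in a block diagonal matrix.\<close>
lemma cluster_tree_start:
  assumes "cluster_tree L n J" "\<tau> \<in> nodes L"
  shows "J \<tau> = [start J \<tau>..<start J \<tau> + length (J \<tau>)]" "start J \<tau> + length (J \<tau>) \<le> n"
proof -
  obtain l i where \<tau>: "\<tau> = (l, i)" "l \<le> L" "i < 2 ^ l" using assms(2) by (auto simp: nodes_def)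
  have "[0..<2 ^ l] = [0..<i] @ i # [Suc i..<2 ^ l]"
    using \<tau> by (metis add_0 le_add_diff_inverse less_imp_le_nat upt_add_eq_append upt_conv_Cons zero_le)
  then obtain S where *: "[0..<n] = concat (map (\<lambda>i. J (l, i)) [0..<i]) @ J \<tau> @ S"
    using cluster_tree_level_concat[OF assms(1) \<tau>(2), symmetric] \<tau> by auto
  have len: "length (concat (map (\<lambda>i. J (l, i)) [0..<i])) = start J \<tau>"
    by (simp add: start_def \<tau> length_concat interv_sum_list_conv_sum_set_nat atLeast0LessThan o_def)
  have "J \<tau> = take (length (J \<tau>)) (drop (start J \<tau>) [0..<n])" unfolding * using len by simp
  moreover have n: "start J \<tau> + length (J \<tau>) \<le> n" using arg_cong[OF *, of length] len by simp
  ultimately show "J \<tau> = [start J \<tau>..<start J \<tau> + length (J \<tau>)]" "start J \<tau> + length (J \<tau>) \<le> n"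
    by (metis add_0 drop_upt take_upt)+
qed

lemma start_children:
  assumes "cluster_tree L n J" "\<tau> \<in> nodes L" "depth \<tau> < L"
  shows "start J (lchild \<tau>) = start J \<tau>"
    and "start J (rchild \<tau>) = start J \<tau> + length (J (lchild \<tau>))"
    and "length (J \<tau>) = length (J (lchild \<tau>)) + length (J (rchild \<tau>))"
proof -
  obtain l i where \<tau>: "\<tau> = (l, i)" "l < L" "i < 2 ^ l" using assms(2,3) by (auto simp: nodes_def)
  have len: "length (J (l, k)) = length (J (Suc l, 2 * k)) + length (J (Suc l, Suc (2 * k)))"
    if "k < 2 ^ l" for k
    using assms(1) \<tau> that by (auto simp: cluster_tree_def nodes_def lchild_def rchild_def)
  have "k \<le> 2 ^ l \<Longrightarrow> (\<Sum>j<2 * k. length (J (Suc l, j))) = (\<Sum>j<k. length (J (l, j)))" for k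
    by (induction k) (auto simp: len)
  from this[of i] show l: "start J (lchild \<tau>) = start J \<tau>"
    using \<tau> by (simp add: start_def lchild_def)
  show "start J (rchild \<tau>) = start J \<tau> + length (J (lchild \<tau>))"
    unfolding l[symmetric] by (simp add: start_def lchild_def rchild_def)
  show "length (J \<tau>) = length (J (lchild \<tau>)) + length (J (rchild \<tau>))"
    using len[of i] \<tau> by (simp add: lchild_def rchild_def)
qed

lemma block_eq_cut:
  assumes "cluster_tree L n J" "M \<in> carrier_mat n n" "\<tau> \<in> nodes L" "\<tau>' \<in> nodes L"
  shows "block J M \<tau> \<tau>' = cut (start J \<tau>) (length (J \<tau>)) (start J \<tau>') (length (J \<tau>')) M"
proof -
  have "set (J \<sigma>) = {start J \<sigma>..<start J \<sigma> + length (J \<sigma>)}" if "\<sigma> \<in> nodes L" for \<sigma>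
    by (subst cluster_tree_start(1)[OF assms(1) that]) simp
  then show ?thesis unfolding block_def
    using submatrix_interval[OF assms(2)] assms(3,4) cluster_tree_start(2)[OF assms(1)] by simp
qed

lemma block_children:
  assumes tree: "cluster_tree L n J" and M: "M \<in> carrier_mat n n"
    and nodes: "\<tau> \<in> nodes L" "\<tau>' \<in> nodes L" and depth: "depth \<tau> < L" "depth \<tau>' < L"
  shows "block J M \<tau> \<tau>' =
    four_block_mat (block J M (lchild \<tau>) (lchild \<tau>')) (block J M (lchild \<tau>) (rchild \<tau>'))
      (block J M (rchild \<tau>) (lchild \<tau>')) (block J M (rchild \<tau>) (rchild \<tau>'))"
proof -
  have "lchild \<sigma> \<in> nodes L \<and> rchild \<sigma> \<in> nodes L" if "\<sigma> \<in> nodes L" "depth \<sigma> < L" for \<sigma>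
    using that by (auto simp: nodes_def lchild_def rchild_def)
  then show ?thesis
    using nodes depth
    by (simp add: block_eq_cut[OF tree M] start_children[OF tree] cut_four_blocks)
qed

section \<open>Two-by-two block identities and orthonormal columns\<close>

lemma diag_block_mat_pair:
  "diag_block_mat [A, B] =
   four_block_mat A (0\<^sub>m (dim_row A) (dim_col B)) (0\<^sub>m (dim_row B) (dim_col A)) B"
  unfolding diag_block_mat.simps(2)[of A "[B]"] Let_def diag_block_mat_singleton ..

text \<open>This merges the factorizations of the four blocks belonging to pairs of children into one
  for the parents.\<close>
lemma four_block_sandwich:
  fixes P1 :: "'a :: comm_semiring_1 mat"
  assumes P: "P1 \<in> carrier_mat p1 r" "P2 \<in> carrier_mat p2 r"
    and Q: "Q1 \<in> carrier_mat q1 s" "Q2 \<in> carrier_mat q2 s"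
    and X: "X1 \<in> carrier_mat r s" "X2 \<in> carrier_mat r s" "X3 \<in> carrier_mat r s" "X4 \<in> carrier_mat r s"
  shows "four_block_mat (P1 * X1 * Q1\<^sup>T) (P1 * X2 * Q2\<^sup>T) (P2 * X3 * Q1\<^sup>T) (P2 * X4 * Q2\<^sup>T) =
    diag_block_mat [P1, P2] * four_block_mat X1 X2 X3 X4 * (diag_block_mat [Q1, Q2])\<^sup>T"
proof -
  have PX: "diag_block_mat [P1, P2] * four_block_mat X1 X2 X3 X4 =
      four_block_mat (P1 * X1) (P1 * X2) (P2 * X3) (P2 * X4)"
    unfolding diag_block_mat_pair using P X
    by (subst mult_four_block_mat[of _ p1 r _ r _ p2 _ _ s _ s]) auto
  have QT: "(diag_block_mat [Q1, Q2])\<^sup>T = four_block_mat (Q1\<^sup>T) (0\<^sub>m s q2) (0\<^sub>m s q1) (Q2\<^sup>T)"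
    unfolding diag_block_mat_pair using Q
    by (subst transpose_four_block_mat[of _ q1 s _ s _ q2]) auto
  show ?thesis unfolding PX QT using P Q X
    by (subst mult_four_block_mat[of _ p1 s _ s _ p2 _ _ q1 _ q2]) auto
qed

lemma orthonormal_cols_iff:
  assumes "W \<in> carrier_mat m k"
  shows "orthonormal_cols W \<longleftrightarrow> W\<^sup>T * W = 1\<^sub>m k"
proof
  assume "orthonormal_cols W"
  then show "W\<^sup>T * W = 1\<^sub>m k" using assms
    by (intro eq_matI) (auto simp: orthonormal_cols_def)
next
  assume eq: "W\<^sup>T * W = 1\<^sub>m k"
  show "orthonormal_cols W" unfolding orthonormal_cols_def
  proof (intro allI impI)
    fix i j assume "i < dim_col W" "j < dim_col W"
    then show "col W i \<bullet> col W j = (if i = j then 1 else 0)"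
      using arg_cong[OF eq, of "\<lambda>X. X $$ (i, j)"] assms by simp
  qed
qed

lemma orthonormal_cols_mult:
  assumes "W \<in> carrier_mat m k" "W' \<in> carrier_mat k k'" "orthonormal_cols W" "orthonormal_cols W'"
  shows "orthonormal_cols (W * W')"
proof -
  have "(W * W')\<^sup>T * (W * W') = W'\<^sup>T * (W\<^sup>T * (W * W'))"
    using assms by (simp add: transpose_mult[of _ m k] assoc_mult_mat[of _ k' k _ m _ k'])
  also have "W\<^sup>T * (W * W') = (W\<^sup>T * W) * W'"
    using assms by (intro assoc_mult_mat[symmetric]) auto
  also have "\<dots> = W'" using assms orthonormal_cols_iff[of W m k] by simp
  finally show ?thesis
    using assms orthonormal_cols_iff[of W' k k'] orthonormal_cols_iff[of "W * W'" m k'] by simp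
qed

lemma orthonormal_cols_diag_block_pair:
  assumes "W \<in> carrier_mat m k" "W' \<in> carrier_mat m' k'" "orthonormal_cols W" "orthonormal_cols W'"
  shows "orthonormal_cols (diag_block_mat [W, W'])"
proof -
  have "(diag_block_mat [W, W'])\<^sup>T * diag_block_mat [W, W'] =
      four_block_mat (W\<^sup>T) (0\<^sub>m k m') (0\<^sub>m k' m) (W'\<^sup>T) *
      four_block_mat W (0\<^sub>m m k') (0\<^sub>m m' k) W'"
    unfolding diag_block_mat_pair using assms
    by (subst transpose_four_block_mat[of _ m k _ k' _ m']) auto
  also have "\<dots> = 1\<^sub>m (k + k')"
    using assms orthonormal_cols_iff[of W m k] orthonormal_cols_iff[of W' m' k']
    by (subst mult_four_block_mat[of _ k m _ m' _ k' _ _ k _ k']) auto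
  finally show ?thesis
    using assms
    by (subst orthonormal_cols_iff[of _ "m + m'" "k + k'"]) (auto simp: diag_block_mat_pair)
qed

text \<open>Multiplication by \<open>W\<^sup>T\<close> from the left and by \<open>W'\<close> from the right recovers \<open>X\<close>.\<close>
lemma orthonormal_sandwich_eq_0:
  assumes W: "W \<in> carrier_mat m k" "orthonormal_cols W"
    and W': "W' \<in> carrier_mat m' k'" "orthonormal_cols W'"
    and X: "X \<in> carrier_mat k k'" and 0: "W * X * W'\<^sup>T = 0\<^sub>m m m'"
  shows "X = 0\<^sub>m k k'"
proof -
  have "X = (W\<^sup>T * W) * X * (W'\<^sup>T * W')"
    using W W' X orthonormal_cols_iff[of W m k] orthonormal_cols_iff[of W' m' k'] by simp
  also have "\<dots> = (W\<^sup>T * W * X) * W'\<^sup>T * W'"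
    using W W' X by (intro assoc_mult_mat[symmetric]) auto
  also have "W\<^sup>T * W * X = W\<^sup>T * (W * X)"
    using W X by (intro assoc_mult_mat) auto
  also have "W\<^sup>T * (W * X) * W'\<^sup>T = W\<^sup>T * (W * X * W'\<^sup>T)"
    using W W' X by (intro assoc_mult_mat) auto
  also have "W\<^sup>T * (W * X * W'\<^sup>T) * W' = 0\<^sub>m k k'"
    unfolding 0 using W W' by simp
  finally show ?thesis .
qed

section \<open>Reading the telescopic recursion block by block\<close>

text \<open>The big bases of an HSS matrix, obtained from the transfer matrices by the nestedness
  condition. The number is the height of the node above the leaves, which makes the recursion
  structural.\<close>

fun nested_basis :: "(node \<Rightarrow> real mat) \<Rightarrow> nat \<Rightarrow> node \<Rightarrow> real mat" where
  "nested_basis W 0 \<tau> = W \<tau>"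
| "nested_basis W (Suc h) \<tau> =
    diag_block_mat [nested_basis W h (lchild \<tau>), nested_basis W h (rchild \<tau>)] * W \<tau>"

locale telescopic =
  fixes L n r :: nat and I :: "node \<Rightarrow> nat list" and U V D :: "node \<Rightarrow> real mat"
  assumes tree: "cluster_tree L n I" and decomposition: "telescopic_decomposition L I r U V D"
begin

text \<open>The tree with respect to which \<open>T l\<close> is partitioned at depth \<open>l\<close>. It lets the inner levels,
  where all blocks have size \<open>2 * r\<close>, and the leaf level be treated alike.\<close>
definition level_tree :: "nat \<Rightarrow> node \<Rightarrow> nat list" where
  "level_tree l = (if l < L then balanced_tree (2 * r) l else I)"

definition level_size :: "nat \<Rightarrow> nat" where
  "level_size l = (if l < L then 2 ^ l * (2 * r) else n)"

abbreviation T :: "nat \<Rightarrow> real mat" where "T \<equiv> telescopic_mat U V D"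

text \<open>The indices \<open>i\<close> and \<open>j\<close> are positions of nodes of depth \<open>l + 1\<close>: their \<open>r\<close> rows and \<open>r\<close>
  columns in \<open>T l\<close> are the ones that the blocks \<open>U (l + 1, i)\<close> and \<open>V (l + 1, j)\<close> act on.\<close>
definition core :: "nat \<Rightarrow> nat \<Rightarrow> nat \<Rightarrow> real mat" where
  "core l i j = cut (i * r) r (j * r) r (T l)"

lemma core_carrier [simp]: "core l i j \<in> carrier_mat r r"
  by (simp add: core_def)

lemma level_tree_leaves: "level_tree L = I"
  by (simp add: level_tree_def)

lemma cluster_tree_level: "l \<le> L \<Longrightarrow> cluster_tree l (level_size l) (level_tree l)"
  using cluster_tree_balanced_tree[of l "2 * r"] tree
  by (auto simp: level_tree_def level_size_def not_less)

lemma sum_level: "l \<le> L \<Longrightarrow> (\<Sum>k<2 ^ l. length (level_tree l (l, k))) = level_size l"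
  using arg_cong[OF cluster_tree_level_concat[OF cluster_tree_level order_refl, of l], of length]
  by (simp add: length_concat interv_sum_list_conv_sum_set_nat atLeast0LessThan o_def)

lemma node_carriers:
  assumes "l \<le> L" "i < 2 ^ l"
  defines "d \<equiv> length (level_tree l (l, i))"
  shows "D (l, i) \<in> carrier_mat d d"
    and "1 \<le> l \<Longrightarrow> U (l, i) \<in> carrier_mat d r" and "1 \<le> l \<Longrightarrow> V (l, i) \<in> carrier_mat d r"
    and "1 \<le> l \<Longrightarrow> orthonormal_cols (U (l, i))" and "1 \<le> l \<Longrightarrow> orthonormal_cols (V (l, i))"
proof -
  have d: "(if l = L then length (I (l, i)) else 2 * r) = d"
    using assms by (auto simp: level_tree_def balanced_tree_leaf)
  have "(l, i) \<in> nodes L" using assms by (simp add: nodes_def)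
  from decomposition[unfolded telescopic_decomposition_def Let_def, THEN bspec, OF this]
  show "D (l, i) \<in> carrier_mat d d"
    and "1 \<le> l \<Longrightarrow> U (l, i) \<in> carrier_mat d r" and "1 \<le> l \<Longrightarrow> V (l, i) \<in> carrier_mat d r"
    and "1 \<le> l \<Longrightarrow> orthonormal_cols (U (l, i))" and "1 \<le> l \<Longrightarrow> orthonormal_cols (V (l, i))"
    unfolding fst_conv d by auto
qed

lemma level_dims:
  assumes "l \<le> L" "k < 2 ^ l"
  shows "dim_row (D (l, k)) = length (level_tree l (l, k))"
    and "dim_col (D (l, k)) = length (level_tree l (l, k))"
    and "1 \<le> l \<Longrightarrow> dim_row (U (l, k)) = length (level_tree l (l, k))"
    and "1 \<le> l \<Longrightarrow> dim_row (V (l, k)) = length (level_tree l (l, k))"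
    and "1 \<le> l \<Longrightarrow> dim_col (U (l, k)) = r" and "1 \<le> l \<Longrightarrow> dim_col (V (l, k)) = r"
  using node_carriers[OF assms] by auto

lemma level_offsets:
  assumes "l \<le> L" "i \<le> 2 ^ l"
  shows "(\<Sum>k<i. dim_row (D (l, k))) = (\<Sum>k<i. length (level_tree l (l, k)))"
    and "(\<Sum>k<i. dim_col (D (l, k))) = (\<Sum>k<i. length (level_tree l (l, k)))"
    and "1 \<le> l \<Longrightarrow> (\<Sum>k<i. dim_row (U (l, k))) = (\<Sum>k<i. length (level_tree l (l, k)))"
    and "1 \<le> l \<Longrightarrow> (\<Sum>k<i. dim_row (V (l, k))) = (\<Sum>k<i. length (level_tree l (l, k)))"
    and "1 \<le> l \<Longrightarrow> (\<Sum>k<i. dim_col (U (l, k))) = i * r"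
    and "1 \<le> l \<Longrightarrow> (\<Sum>k<i. dim_col (V (l, k))) = i * r"
  using assms level_dims[OF assms(1)] by auto

lemma blkdiag_carriers:
  assumes "l \<le> L"
  shows "blkdiag D l \<in> carrier_mat (level_size l) (level_size l)"
    and "1 \<le> l \<Longrightarrow> blkdiag U l \<in> carrier_mat (level_size l) (2 ^ l * r)"
    and "1 \<le> l \<Longrightarrow> blkdiag V l \<in> carrier_mat (level_size l) (2 ^ l * r)"
  using level_offsets[OF assms order_refl] sum_level[OF assms]
  by (auto simp: blkdiag_def dim_diag_block_map intro!: carrier_matI)

lemma telescopic_mat_carrier: "l \<le> L \<Longrightarrow> T l \<in> carrier_mat (level_size l) (level_size l)"
proof (induction l)
  case 0
  then show ?case using node_carriers(1)[of 0 0] sum_level[of 0] by (simp add: root_def)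
next
  case (Suc l)
  have "level_size l = 2 ^ Suc l * r" using Suc.prems by (simp add: level_size_def)
  then show ?case using Suc blkdiag_carriers[of "Suc l"] by auto
qed

text \<open>Both outer factors in the recursion are block diagonal, so each block of \<open>T (l + 1)\<close> sees a
  single core of \<open>T l\<close>.\<close>
lemma telescopic_block:
  assumes l: "Suc l \<le> L" and i: "i < 2 ^ Suc l" and j: "j < 2 ^ Suc l"
  shows "block (level_tree (Suc l)) (T (Suc l)) (Suc l, i) (Suc l, j) =
    (if i = j then D (Suc l, i)
     else 0\<^sub>m (length (level_tree (Suc l) (Suc l, i))) (length (level_tree (Suc l) (Suc l, j)))) +
    U (Suc l, i) * core l i j * (V (Suc l, j))\<^sup>T"
proof -
  let ?J = "level_tree (Suc l)" and ?m = "Suc l"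
  let ?s = "\<lambda>i. start ?J (?m, i)" and ?d = "\<lambda>i. length (?J (?m, i))"
  have s: "?s i = (\<Sum>k<i. ?d k)" for i by (simp add: start_def)
  have tr: "cluster_tree ?m (level_size ?m) ?J" by (rule cluster_tree_level[OF l])
  have nd: "(?m, i) \<in> nodes ?m" "(?m, j) \<in> nodes ?m" using i j by (auto simp: nodes_def)
  have size: "level_size l = 2 ^ ?m * r" using l by (simp add: level_size_def)
  have Tl: "T l \<in> carrier_mat (2 ^ ?m * r) (2 ^ ?m * r)"
    using telescopic_mat_carrier[of l] l unfolding size by simp
  note bd = blkdiag_carriers[OF l]
  let ?UTV = "blkdiag U ?m * T l * (blkdiag V ?m)\<^sup>T"
  have UTV: "?UTV \<in> carrier_mat (level_size ?m) (level_size ?m)"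
    using bd by auto
  note dm = level_dims[OF l i] level_dims[OF l j]
  note off = level_offsets[OF l less_imp_le[OF i]] level_offsets[OF l less_imp_le[OF j]]
    level_offsets[OF l order_refl]
  have "block ?J (T ?m) (?m, i) (?m, j) = cut (?s i) (?d i) (?s j) (?d j) (blkdiag D ?m + ?UTV)"
    using block_eq_cut[OF tr telescopic_mat_carrier[OF l] nd] by simp
  also have "\<dots> = cut (?s i) (?d i) (?s j) (?d j) (blkdiag D ?m) +
      cut (?s i) (?d i) (?s j) (?d j) ?UTV"
    using cut_add[OF bd(1) UTV] cluster_tree_start(2)[OF tr] nd by simp
  also have "cut (?s i) (?d i) (?s j) (?d j) (blkdiag D ?m) =
      (if i = j then D (?m, i) else 0\<^sub>m (?d i) (?d j))"
    using cut_diag_block[OF i j, of "\<lambda>k. D (?m, k)"] dm off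
    by (simp add: s blkdiag_def)
  also have "cut (?s i) (?d i) (?s j) (?d j) ?UTV = U (?m, i) * core l i j * (V (?m, j))\<^sup>T"
    using cut_diag_block_sandwich[OF i j, of "T l" "\<lambda>k. U (?m, k)" "\<lambda>k. V (?m, k)"] Tl dm off
    by (simp add: s blkdiag_def core_def)
  finally show ?thesis .
qed

text \<open>Orthonormality of columns is inherited by block diagonal pairs and by products.\<close>
lemma nested_basis_orthonormal:
  assumes W: "\<And>l i. 1 \<le> l \<Longrightarrow> l \<le> L \<Longrightarrow> i < 2 ^ l \<Longrightarrow>
      W (l, i) \<in> carrier_mat (length (level_tree l (l, i))) r \<and> orthonormal_cols (W (l, i))"
    and "1 \<le> l" "l \<le> L" "i < 2 ^ l"
  shows "nested_basis W (L - l) (l, i) \<in> carrier_mat (length (I (l, i))) r \<and>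
    orthonormal_cols (nested_basis W (L - l) (l, i))"
  using assms(3,2,4)
proof (induction l arbitrary: i rule: inc_induct)
  case base
  then show ?case using W[of L i] by (simp add: level_tree_def)
next
  case (step l)
  let ?P = "nested_basis W (L - Suc l) (Suc l, 2 * i)"
  let ?Q = "nested_basis W (L - Suc l) (Suc l, Suc (2 * i))"
  have "L - l = Suc (L - Suc l)" using step by simp
  then have nb: "nested_basis W (L - l) (l, i) = diag_block_mat [?P, ?Q] * W (l, i)"
    by (simp add: lchild_def rchild_def)
  have IH: "?P \<in> carrier_mat (length (I (Suc l, 2 * i))) r" "orthonormal_cols ?P"
    "?Q \<in> carrier_mat (length (I (Suc l, Suc (2 * i)))) r" "orthonormal_cols ?Q"
    using step.IH[of "2 * i"] step.IH[of "Suc (2 * i)"] step.prems by auto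
  have len: "length (I (l, i)) = length (I (Suc l, 2 * i)) + length (I (Suc l, Suc (2 * i)))"
    using start_children(3)[OF tree, of "(l, i)"] step
    by (simp add: nodes_def lchild_def rchild_def)
  have "diag_block_mat [?P, ?Q] \<in> carrier_mat (length (I (l, i))) (2 * r)"
    using IH len by (auto simp: diag_block_mat_pair)
  moreover have "W (l, i) \<in> carrier_mat (2 * r) r" "orthonormal_cols (W (l, i))"
    using W[of l i] step by (auto simp: level_tree_def balanced_tree_leaf)
  ultimately show ?case
    unfolding nb
    using orthonormal_cols_mult orthonormal_cols_diag_block_pair[OF IH(1,3,2,4)] by auto
qed

abbreviation Ubig :: "node \<Rightarrow> real mat" where "Ubig \<tau> \<equiv> nested_basis U (L - depth \<tau>) \<tau>"
abbreviation Vbig :: "node \<Rightarrow> real mat" where "Vbig \<tau> \<equiv> nested_basis V (L - depth \<tau>) \<tau>"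

lemma big_carriers:
  assumes "1 \<le> l" "l \<le> L" "i < 2 ^ l"
  shows "Ubig (l, i) \<in> carrier_mat (length (I (l, i))) r" "orthonormal_cols (Ubig (l, i))"
    "Vbig (l, i) \<in> carrier_mat (length (I (l, i))) r" "orthonormal_cols (Vbig (l, i))"
  using nested_basis_orthonormal[of U l i] nested_basis_orthonormal[of V l i] node_carriers assms
  by auto

text \<open>The fine partition of \<open>T l\<close> into cores refines the partition by nodes of depth \<open>l\<close>, as
  \<open>2 * r = r + r\<close>.\<close>
lemma core_children:
  assumes "l < L" "i < 2 ^ l" "j < 2 ^ l"
  shows "block (level_tree l) (T l) (l, i) (l, j) =
    four_block_mat (core l (2 * i) (2 * j)) (core l (2 * i) (Suc (2 * j)))
      (core l (Suc (2 * i)) (2 * j)) (core l (Suc (2 * i)) (Suc (2 * j)))"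
proof -
  have "block (level_tree l) (T l) (l, i) (l, j) =
      cut (i * (2 * r)) (r + r) (j * (2 * r)) (r + r) (T l)"
    using block_eq_cut[OF cluster_tree_level telescopic_mat_carrier, of l "(l, i)" "(l, j)"] assms
    by (simp add: nodes_def start_def level_tree_def balanced_tree_leaf mult_2)
  then show ?thesis
    unfolding cut_four_blocks by (simp add: core_def algebra_simps)
qed

text \<open>The induction runs from the leaf level towards the root. It needs all pairs of distinct nodes
  of equal depth, since the children of two siblings are not siblings of each other.\<close>
lemma off_diagonal_block:
  assumes "l < L" "i < 2 ^ Suc l" "j < 2 ^ Suc l" "i \<noteq> j"
  shows "block I (T L) (Suc l, i) (Suc l, j) =
    Ubig (Suc l, i) * core l i j * (Vbig (Suc l, j))\<^sup>T"
proof -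
  obtain L' where L: "L = Suc L'" using assms(1) by (cases L) auto
  have "l \<le> L'" using assms(1) L by simp
  then show ?thesis using assms(2-)
  proof (induction l arbitrary: i j rule: inc_induct)
    case base
    have "block I (T L) (L, i) (L, j) = 0\<^sub>m (length (I (L, i))) (length (I (L, j))) +
        U (L, i) * core L' i j * (V (L, j))\<^sup>T"
      using telescopic_block[of L' i j, folded L] base L[symmetric] level_tree_leaves by simp
    moreover have "U (L, i) * core L' i j * (V (L, j))\<^sup>T \<in>
        carrier_mat (length (I (L, i))) (length (I (L, j)))"
      using node_carriers(2)[of L i] node_carriers(3)[of L j] base L[symmetric] level_tree_leaves
      by auto
    ultimately show ?case using L by simp
  next
    case (step l)
    let ?l = "Suc l"
    have l: "?l < L" using step L by simp
    have nd: "(?l, i) \<in> nodes L" "(?l, j) \<in> nodes L" using step l by (auto simp: nodes_def)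
    have TL: "T L \<in> carrier_mat n n"
      using telescopic_mat_carrier[of L] by (simp add: level_size_def)
    have off: "block I (T L) (Suc ?l, i') (Suc ?l, j') =
        Ubig (Suc ?l, i') * core ?l i' j' * (Vbig (Suc ?l, j'))\<^sup>T"
      if "i' \<in> {2 * i, Suc (2 * i)}" "j' \<in> {2 * j, Suc (2 * j)}" for i' j'
    proof -
      have "i' < 2 ^ Suc ?l" "j' < 2 ^ Suc ?l" "i' \<noteq> j'" using that step.prems by auto
      then show ?thesis by (rule step.IH)
    qed
    note U2 = big_carriers(1)[of "Suc ?l" "2 * i"] big_carriers(1)[of "Suc ?l" "Suc (2 * i)"]
    note V2 = big_carriers(3)[of "Suc ?l" "2 * j"] big_carriers(3)[of "Suc ?l" "Suc (2 * j)"]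
    let ?P = "diag_block_mat [Ubig (Suc ?l, 2 * i), Ubig (Suc ?l, Suc (2 * i))]"
    let ?Q = "diag_block_mat [Vbig (Suc ?l, 2 * j), Vbig (Suc ?l, Suc (2 * j))]"
    have "L - ?l = Suc (L - Suc ?l)" using l by simp
    then have nb: "Ubig (?l, i) = ?P * U (?l, i)" "Vbig (?l, j) = ?Q * V (?l, j)"
      by (simp_all add: lchild_def rchild_def)
    have P: "?P \<in> carrier_mat (length (I (?l, i))) (2 * r)"
      using U2 step.prems l start_children(3)[OF tree nd(1)]
      by (auto simp: diag_block_mat_pair lchild_def rchild_def)
    have Q: "?Q \<in> carrier_mat (length (I (?l, j))) (2 * r)"
      using V2 step.prems l start_children(3)[OF tree nd(2)]
      by (auto simp: diag_block_mat_pair lchild_def rchild_def)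
    have Ui: "U (?l, i) \<in> carrier_mat (2 * r) r" and Vj: "V (?l, j) \<in> carrier_mat (2 * r) r"
      using node_carriers(2)[of ?l i] node_carriers(3)[of ?l j] step.prems l
      by (auto simp: level_tree_def balanced_tree_leaf)
    let ?X = "U (?l, i) * core l i j * (V (?l, j))\<^sup>T"
    have X: "?X \<in> carrier_mat (2 * r) (2 * r)" using Ui Vj by auto
    \<comment> \<open>Children of distinct nodes are distinct, so \<open>off\<close> covers all four blocks.\<close>
    have "block I (T L) (?l, i) (?l, j) =
        four_block_mat (block I (T L) (Suc ?l, 2 * i) (Suc ?l, 2 * j))
          (block I (T L) (Suc ?l, 2 * i) (Suc ?l, Suc (2 * j)))
          (block I (T L) (Suc ?l, Suc (2 * i)) (Suc ?l, 2 * j))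
          (block I (T L) (Suc ?l, Suc (2 * i)) (Suc ?l, Suc (2 * j)))"
      using block_children[OF tree TL nd] l by (simp add: lchild_def rchild_def)
    also have "\<dots> = ?P * four_block_mat (core ?l (2 * i) (2 * j)) (core ?l (2 * i) (Suc (2 * j)))
      (core ?l (Suc (2 * i)) (2 * j)) (core ?l (Suc (2 * i)) (Suc (2 * j))) * ?Q\<^sup>T"
      unfolding off[OF insertI1 insertI1] off[OF insertI1 insertI2[OF singletonI]]
        off[OF insertI2[OF singletonI] insertI1]
        off[OF insertI2[OF singletonI] insertI2[OF singletonI]]
      using U2 V2 step.prems l
      by (intro four_block_sandwich[of _ _ r _ _ _ _ r]) auto
    \<comment> \<open>The four cores form an off-diagonal block of \<open>T ?l\<close>, to which \<open>D\<close> does not contribute.\<close>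
    also have "four_block_mat (core ?l (2 * i) (2 * j)) (core ?l (2 * i) (Suc (2 * j)))
        (core ?l (Suc (2 * i)) (2 * j)) (core ?l (Suc (2 * i)) (Suc (2 * j))) = ?X"
      using core_children[of ?l i j] telescopic_block[of l i j] step.prems l X
      by (simp add: level_tree_def balanced_tree_leaf)
    also have "?P * ?X * ?Q\<^sup>T = (?P * U (?l, i)) * core l i j * ((V (?l, j))\<^sup>T * ?Q\<^sup>T)"
      using P Q Ui Vj X
      by (smt (verit) assoc_mult_mat core_carrier mult_carrier_mat transpose_carrier_mat)
    also have "(V (?l, j))\<^sup>T * ?Q\<^sup>T = (?Q * V (?l, j))\<^sup>T"
      using transpose_mult[OF Q Vj] by simp
    finally show ?case unfolding nb .
  qed
qed

end

section \<open>Standard decompositions\<close>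

locale standard_telescopic = telescopic +
  assumes standard: "standard_decomposition L I r U V D"
begin

text \<open>At depth 0, where being standard imposes no condition, the root block is all of
  \<open>T 0 = D root\<close>.\<close>
lemma diagonal_block:
  assumes "l \<le> L" "i < 2 ^ l"
  shows "block (level_tree l) (T l) (l, i) (l, i) = D (l, i)"
proof (cases "l = 0")
  case True
  then show ?thesis
    using block_eq_cut[OF cluster_tree_level telescopic_mat_carrier, of 0 "(0, 0)" "(0, 0)"] assms
      node_carriers(1)[of 0 0]
    by (simp add: nodes_def start_def root_def cut_whole)
next
  case False
  then show ?thesis
    using standard assms unfolding standard_decomposition_def level_tree_def
    by (auto simp: nodes_def)
qed

text \<open>The block of \<open>T (l + 1)\<close> at a node is \<open>D\<close> plus a term with orthonormal outer factors; if the
  block equals \<open>D\<close>, then that term and therefore its core are zero.\<close>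
lemma core_diagonal:
  assumes "l < L" "i < 2 ^ Suc l"
  shows "core l i i = 0\<^sub>m r r"
proof -
  let ?d = "length (level_tree (Suc l) (Suc l, i))"
  have l: "Suc l \<le> L" "1 \<le> Suc l" using assms by auto
  note car = node_carriers(1)[OF l(1) assms(2)] node_carriers(2-)[OF l(1) assms(2) l(2)]
  let ?X = "U (Suc l, i) * core l i i * (V (Suc l, i))\<^sup>T"
  have X: "?X \<in> carrier_mat ?d ?d" using car by auto
  have "D (Suc l, i) = D (Suc l, i) + ?X"
    using telescopic_block[OF l(1) assms(2,2)] diagonal_block[OF l(1) assms(2)] by simp
  then have "0\<^sub>m ?d ?d = (- D (Suc l, i)) + (D (Suc l, i) + ?X)"
    using car(1) by (metis uminus_l_inv_mat)
  also have "\<dots> = (- D (Suc l, i) + D (Suc l, i)) + ?X"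
    using car(1) X by (intro assoc_add_mat[symmetric]) auto
  also have "\<dots> = ?X" using car(1) X by simp
  finally show ?thesis
    using orthonormal_sandwich_eq_0[OF car(2,4,3,5) core_carrier] by simp
qed

lemma D_eq_four_block:
  assumes "l < L" "i < 2 ^ l"
  shows "D (l, i) = four_block_mat (0\<^sub>m r r) (core l (2 * i) (Suc (2 * i)))
    (core l (Suc (2 * i)) (2 * i)) (0\<^sub>m r r)"
  using core_children[OF assms assms(2)] diagonal_block[of l i] core_diagonal[of l "2 * i"]
    core_diagonal[of l "Suc (2 * i)"] assms by simp

text \<open>The cores for nodes of some depth lie in the matrix of the depth above, and siblings
  have positive depth, so the subtraction does not truncate.\<close>
definition coupling :: "node \<Rightarrow> node \<Rightarrow> real mat" where
  "coupling \<tau> \<tau>' = core (depth \<tau> - 1) (snd \<tau>) (snd \<tau>')"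

lemma hss_factorization_telescopic:
  "hss_factorization L n I r (T L) Ubig Vbig U V coupling"
  unfolding hss_factorization_def
proof (intro conjI ballI allI impI)
  show "T L \<in> carrier_mat n n" using telescopic_mat_carrier[of L] by (simp add: level_size_def)
next
  fix \<tau> assume "\<tau> \<in> nodes L" "1 \<le> depth \<tau>"
  then obtain l i where "\<tau> = (l, i)" "1 \<le> l" "l \<le> L" "i < 2 ^ l" by (auto simp: nodes_def)
  then show "Ubig \<tau> \<in> carrier_mat (length (I \<tau>)) r" "orthonormal_cols (Ubig \<tau>)"
    "Vbig \<tau> \<in> carrier_mat (length (I \<tau>)) r" "orthonormal_cols (Vbig \<tau>)"
    using big_carriers by auto
next
  fix \<tau> \<tau>' assume "siblings L \<tau> \<tau>'"
  then obtain l i j where "\<tau> = (Suc l, i)" "\<tau>' = (Suc l, j)" "l < L" "i < 2 ^ Suc l" "j < 2 ^ Suc l"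
    "i \<noteq> j"
    by (auto simp: siblings_def nodes_def lchild_def rchild_def)
  then show "coupling \<tau> \<tau>' \<in> carrier_mat r r"
    "block I (T L) \<tau> \<tau>' = Ubig \<tau> * coupling \<tau> \<tau>' * (Vbig \<tau>')\<^sup>T"
    using off_diagonal_block by (auto simp: coupling_def)
next
  fix \<tau> assume "\<tau> \<in> nodes L" "1 \<le> depth \<tau> \<and> depth \<tau> < L"
  then obtain l i where \<tau>: "\<tau> = (l, i)" "1 \<le> l" "l < L" "i < 2 ^ l" by (auto simp: nodes_def)
  then show "U \<tau> \<in> carrier_mat (2 * r) r" "orthonormal_cols (U \<tau>)"
    "V \<tau> \<in> carrier_mat (2 * r) r" "orthonormal_cols (V \<tau>)"
    using node_carriers[of l i] by (auto simp: level_tree_def balanced_tree_leaf)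
  have "L - l = Suc (L - Suc l)" using \<tau> by simp
  then show "Ubig \<tau> = diag_block_mat [Ubig (lchild \<tau>), Ubig (rchild \<tau>)] * U \<tau>"
    "Vbig \<tau> = diag_block_mat [Vbig (lchild \<tau>), Vbig (rchild \<tau>)] * V \<tau>"
    by (simp_all add: \<tau>(1) lchild_def rchild_def)
qed

end

theorem proposition4p4:
  fixes L n r :: nat and I :: "node \<Rightarrow> nat list"
    and U V D :: "node \<Rightarrow> real mat" and A :: "real mat"
  assumes "cluster_tree L n I"
    and "telescopic_decomposition L I r U V D"
    and "standard_decomposition L I r U V D"
    and "A = telescopic_mat U V D L"
  shows "\<exists>At :: node \<Rightarrow> node \<Rightarrow> real mat.
     (\<forall>\<tau>\<in>nodes L. depth \<tau> < L \<longrightarrow>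
        (let \<alpha> = lchild \<tau>; \<beta> = rchild \<tau> in
          At \<alpha> \<beta> \<in> carrier_mat r r \<and> At \<beta> \<alpha> \<in> carrier_mat r r \<and>
          D \<tau> = four_block_mat (0\<^sub>m r r) (At \<alpha> \<beta>) (At \<beta> \<alpha>) (0\<^sub>m r r))) \<and>
     hss_matrix L n I r A \<and>
     data_sparse_representation L n I r A U V At (\<lambda>\<alpha>. block I A \<alpha> \<alpha>)"
proof -
  interpret standard_telescopic L n r I U V D
    using assms by unfold_locales
  have fact: "hss_factorization L n I r A Ubig Vbig U V coupling"
    using hss_factorization_telescopic assms(4) by simp
  show ?thesis
  proof (intro exI[of _ coupling] conjI ballI impI)
    fix \<tau> assume "\<tau> \<in> nodes L" "depth \<tau> < L"
    then obtain l i where "\<tau> = (l, i)" "l < L" "i < 2 ^ l" by (auto simp: nodes_def)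
    then show "let \<alpha> = lchild \<tau>; \<beta> = rchild \<tau> in
        coupling \<alpha> \<beta> \<in> carrier_mat r r \<and> coupling \<beta> \<alpha> \<in> carrier_mat r r \<and>
        D \<tau> = four_block_mat (0\<^sub>m r r) (coupling \<alpha> \<beta>) (coupling \<beta> \<alpha>) (0\<^sub>m r r)"
      using D_eq_four_block[of l i] by (simp add: coupling_def lchild_def rchild_def)
  next
    show "hss_matrix L n I r A" using fact unfolding hss_matrix_def by blast
  next
    show "data_sparse_representation L n I r A U V coupling (\<lambda>\<alpha>. block I A \<alpha> \<alpha>)"
      unfolding data_sparse_representation_def
      by (intro conjI exI[of _ Ubig] exI[of _ Vbig] fact) auto
  qed
qed

end
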